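(* Let $H$ be a finite graph on at least $12$ vertices. Then at least one of the graphs $H$ and $\overline{H}$ (the complement of $H$), call it $X$, satisfies one of the following: (i) $X$ is a clique; (ii) $X$ is a forest with a unique vertex of maximum degree; (iii) the $2$-core of $X$ is isomorphic to $K_{2,p}$ or to $K_{1,1,p}$ for some $p\geq 3$; (iv) the $3^*$-core of $X$ is $3$-connected and not a clique.
   Context: The $2$-core of a graph is obtained by iteratively removing vertices having fewer than $2$ neighbours (in the current graph). The $3^*$-core of a graph is obtained by iteratively removing vertices which have at most $2$ neighbours and removing pairs of distinct vertices $u,v$ with $|N[u]\cup N[v]|\leq 4$, where $N[v]$ is the closed neighbourhood of $v$ in the current graph. $K_{2,p}$ is the complete bipartite graph with parts of sizes $2$ and $p$, and $K_{1,1,p}$ is the complete tripartite graph with parts of sizes $1,1,p$. A graph is $k$-connected if it has at least $k+1$ vertices and remains connected after removing any $k-1$ vertices. *)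

theory Defs
  imports "Graph_Theory.Graph_Theory"
begin

text \<open>Finite simple graphs are the finite, symmetric, loop-free digraphs (locale \<^locale>\<open>graph\<close>,
  respectively \<^locale>\<open>pair_graph\<close>): an undirected edge is a pair of opposite arcs. The induced
  subgraph, connectedness, and complete (bipartite) graphs are those of the library.\<close>

definition complement_graph :: "'a pair_pre_digraph \<Rightarrow> 'a pair_pre_digraph" where
  "complement_graph G =
     \<lparr> pverts = pverts G,
       parcs = {(u, v). u \<in> pverts G \<and> v \<in> pverts G \<and> u \<noteq> v \<and> (u, v) \<notin> parcs G} \<rparr>"

definition neighbours :: "('a,'b) pre_digraph \<Rightarrow> 'a \<Rightarrow> 'a set" where
  "neighbours G v = {w. v \<rightarrow>\<^bsub>G\<^esub> w}"

definition closed_neighbours :: "('a,'b) pre_digraph \<Rightarrow> 'a \<Rightarrow> 'a set" where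
  "closed_neighbours G v = insert v (neighbours G v)"

definition clique :: "('a,'b) pre_digraph \<Rightarrow> bool" where
  "clique G \<longleftrightarrow> K\<^bsub>card (verts G)\<^esub> G"

text \<open>The library's \<^const>\<open>forest\<close> is a notion for directed graphs: in a symmetric digraph it
  counts the two arcs of an edge as a cycle. The cycles of an undirected graph are the directed
  cycles of length at least 3.\<close>

definition undirected_forest :: "('a,'b) pre_digraph \<Rightarrow> bool" where
  "undirected_forest G \<longleftrightarrow> (\<nexists>p. pre_digraph.cycle G p \<and> 3 \<le> length p)"

text \<open>In a symmetric digraph the out-degree is the degree of the undirected graph.\<close>

definition max_degree_vertex :: "('a,'b) pre_digraph \<Rightarrow> 'a \<Rightarrow> bool" where
  "max_degree_vertex G v \<longleftrightarrow>
     v \<in> verts G \<and> (\<forall>w \<in> verts G. out_degree G w \<le> out_degree G v)"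

definition complete_tripartite_digraph ::
  "nat \<Rightarrow> nat \<Rightarrow> nat \<Rightarrow> ('a,'b) pre_digraph \<Rightarrow> bool" (\<open>K\<^bsub>_,_,_\<^esub>\<close>) where
  "complete_tripartite_digraph l m n G \<longleftrightarrow> graph G \<and>
     (\<exists>U V W. verts G = U \<union> V \<union> W \<and> U \<inter> V = {} \<and> U \<inter> W = {} \<and> V \<inter> W = {}
        \<and> card U = l \<and> card V = m \<and> card W = n
        \<and> arcs_ends G = U \<times> V \<union> V \<times> U \<union> U \<times> W \<union> W \<times> U \<union> V \<times> W \<union> W \<times> V)"

text \<open>Intended for \<open>k \<ge> 1\<close>.\<close>

definition k_connected :: "nat \<Rightarrow> ('a,'b) pre_digraph \<Rightarrow> bool" where
  "k_connected k G \<longleftrightarrow> k + 1 \<le> card (verts G) \<and>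
     (\<forall>S \<subseteq> verts G. card S = k - 1 \<longrightarrow> connected (G \<restriction> (verts G - S)))"

text \<open>\<open>R G T\<close> says that the vertex set \<open>T\<close> may be removed from the current graph \<open>G\<close>. The core
  is the graph in which the removal process ends; for the two removal rules below it does not
  depend on the choices made (lemmas \<open>two_core_unique\<close> and \<open>three_star_core_unique\<close>).\<close>

inductive removal_step ::
  "(('a,'b) pre_digraph \<Rightarrow> 'a set \<Rightarrow> bool) \<Rightarrow> ('a,'b) pre_digraph \<Rightarrow> ('a,'b) pre_digraph \<Rightarrow> bool"
  for R where
  "R G T \<Longrightarrow> removal_step R G (G \<restriction> (verts G - T))"

definition is_core ::
  "(('a,'b) pre_digraph \<Rightarrow> 'a set \<Rightarrow> bool) \<Rightarrow> ('a,'b) pre_digraph \<Rightarrow> ('a,'b) pre_digraph \<Rightarrow> bool"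
  where "is_core R G C \<longleftrightarrow> (removal_step R)\<^sup>*\<^sup>* G C \<and> (\<nexists>T. R C T)"

definition two_removable :: "('a,'b) pre_digraph \<Rightarrow> 'a set \<Rightarrow> bool" where
  "two_removable G T \<longleftrightarrow> (\<exists>v \<in> verts G. T = {v} \<and> card (neighbours G v) < 2)"

definition three_star_removable :: "('a,'b) pre_digraph \<Rightarrow> 'a set \<Rightarrow> bool" where
  "three_star_removable G T \<longleftrightarrow>
     (\<exists>v \<in> verts G. T = {v} \<and> card (neighbours G v) \<le> 2) \<or>
     (\<exists>u \<in> verts G. \<exists>v \<in> verts G. u \<noteq> v \<and> T = {u, v} \<and>
        card (closed_neighbours G u \<union> closed_neighbours G v) \<le> 4)"

definition two_core :: "('a,'b) pre_digraph \<Rightarrow> ('a,'b) pre_digraph" where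
  "two_core G = (THE C. is_core two_removable G C)"

definition three_star_core :: "('a,'b) pre_digraph \<Rightarrow> ('a,'b) pre_digraph" where
  "three_star_core G = (THE C. is_core three_star_removable G C)"


subsection \<open>Well-definedness\<close>

lemma pair_graph_complement_graph:
  assumes "pair_graph G" shows "pair_graph (complement_graph G)"
proof -
  interpret pair_graph G by fact
  have "parcs (complement_graph G) \<subseteq> pverts G \<times> pverts G"
    by (auto simp: complement_graph_def)
  then have "finite (parcs (complement_graph G))"
    using pair_finite_verts by (meson finite_SigmaI finite_subset)
  then show ?thesis
    using pair_finite_verts
    by unfold_locales
      (auto simp: complement_graph_def symmetric_def intro!: symI dest: arcs_symmetric)
qed

lemma induce_induce: "W \<subseteq> V \<Longrightarrow> (G \<restriction> V) \<restriction> W = G \<restriction> W"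
  by (auto simp: induce_subgraph_def)

lemma induce_verts: "wf_digraph G \<Longrightarrow> G \<restriction> verts G = G"
  by (cases G) (auto simp: induce_subgraph_def wf_digraph_def)

lemma neighbours_induce: "neighbours (G \<restriction> W) v \<subseteq> neighbours G v \<inter> W"
  by (auto simp: neighbours_def arcs_ends_conv)

lemma graph_induce:
  assumes "W \<subseteq> verts G" "graph G" shows "graph (G \<restriction> W)"
proof -
  interpret graph G by fact
  have "induced_subgraph (G \<restriction> W) G" using assms(1) by (rule induced_induce)
  then have "digraph (G \<restriction> W)" "sym_digraph (G \<restriction> W)"
    by (rule digraphI_induced, rule induced_graph_imp_graph)
  then show ?thesis by (simp add: graph_def pseudo_graph_def digraph_def)
qed

lemma graph_wf: "graph G \<Longrightarrow> wf_digraph G"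
  by (simp add: graph_def digraph_def fin_digraph_def)

lemma graph_fin_verts: "graph G \<Longrightarrow> finite (verts G)"
  by (simp add: graph_def digraph_def fin_digraph.finite_verts)

lemma not_in_neighbours: "graph G \<Longrightarrow> v \<notin> neighbours G v"
  by (auto simp: neighbours_def graph_def digraph_def dest: loopfree_digraph.adj_not_same)

lemma finite_neighbours: "graph G \<Longrightarrow> finite (neighbours G v)"
  by (rule finite_subset[of _ "head G ` arcs G"])
    (auto simp: neighbours_def arcs_ends_conv graph_def digraph_def fin_digraph.finite_arcs)

lemma is_core_ex1:
  assumes G: "graph G"
    and sub: "\<And>G T. R G T \<Longrightarrow> T \<noteq> {} \<and> T \<subseteq> verts G"
    and mono: "\<And>G T W. \<lbrakk>graph G; R G T; W \<subseteq> verts G; T \<inter> W \<noteq> {}\<rbrakk> \<Longrightarrow> \<exists>T'. R (G \<restriction> W) T'"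
  shows "\<exists>!C. is_core R G C"
proof -
  have ex: "\<exists>C. is_core R G C" if "graph G" for G
    using that
  proof (induction "card (verts G)" arbitrary: G rule: less_induct)
    case less
    show ?case
    proof (cases "\<exists>T. R G T")
      case True
      then obtain T where T: "R G T" by blast
      let ?G = "G \<restriction> (verts G - T)"
      have "card (verts ?G) < card (verts G)"
        using sub[OF T] graph_fin_verts[OF less.prems] by (auto intro!: psubset_card_mono)
      then obtain C where "is_core R ?G C" using less graph_induce[of "verts G - T" G] by blast
      then show ?thesis
        using converse_rtranclp_into_rtranclp[of "removal_step R" G ?G C]
          removal_step.intros[of R G T] T
        unfolding is_core_def by blast
    qed (auto simp: is_core_def)
  qed
  have reach: "\<exists>V \<subseteq> verts G. C = G \<restriction> V" if "(removal_step R)\<^sup>*\<^sup>* G C" for C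
    using that
  proof (induction rule: rtranclp_induct)
    case base
    then show ?case using induce_verts[of G] G graph_wf by fastforce
  next
    case (step C D)
    then obtain V where V: "V \<subseteq> verts G" "C = G \<restriction> V" by blast
    from step(2) obtain T where "D = C \<restriction> (verts C - T)" by cases
    with V show ?case by (auto simp: induce_induce intro!: exI[of _ "V - T"])
  qed
  have le: "W \<subseteq> verts C"
    if "(removal_step R)\<^sup>*\<^sup>* G C" "W \<subseteq> verts G" "\<nexists>T. R (G \<restriction> W) T" for C W
    using that(1)
  proof (induction rule: rtranclp_induct)
    case base
    then show ?case using that by simp
  next
    case (step C D)
    obtain V where V: "V \<subseteq> verts G" "C = G \<restriction> V" using reach[OF step(1)] by blast
    from step(2) obtain T where T: "D = C \<restriction> (verts C - T)" "R C T" by cases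
    have "C \<restriction> W = G \<restriction> W" using V step.IH by (auto simp: induce_induce)
    then have "T \<inter> W = {}"
      using mono[of C T W] T(2) step.IH V graph_induce[of V G] G that(3) by auto
    then show ?case using T(1) step.IH by auto
  qed
  have "C = D" if C: "is_core R G C" and D: "is_core R G D" for C D
  proof -
    obtain V where V: "V \<subseteq> verts G" "C = G \<restriction> V" using reach C by (auto simp: is_core_def)
    obtain W where W: "W \<subseteq> verts G" "D = G \<restriction> W" using reach D by (auto simp: is_core_def)
    have "W \<subseteq> V" using le[of C W] C D V W by (auto simp: is_core_def)
    moreover have "V \<subseteq> W" using le[of D V] C D V W by (auto simp: is_core_def)
    ultimately show ?thesis using V W by simp
  qed
  then show ?thesis using ex[OF G] by blast
qed

lemma card_neighbours_induce:
  "graph G \<Longrightarrow> card (neighbours (G \<restriction> W) v) \<le> card (neighbours G v)"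
  by (intro card_mono finite_neighbours) (use neighbours_induce in fastforce)+

lemma two_core_unique:
  assumes "graph G" shows "\<exists>!C. is_core two_removable G C"
proof (rule is_core_ex1[OF assms])
  fix G :: "('a,'b) pre_digraph" and T W
  assume G: "graph G" and T: "two_removable G T" and W: "W \<subseteq> verts G" "T \<inter> W \<noteq> {}"
  then obtain v where v: "v \<in> W" "card (neighbours G v) < 2"
    by (auto simp: two_removable_def)
  have "card (neighbours (G \<restriction> W) v) < 2"
    using card_neighbours_induce[OF G] v(2) by (rule le_less_trans)
  then show "\<exists>T'. two_removable (G \<restriction> W) T'"
    using v(1) unfolding two_removable_def induce_subgraph_verts by blast
qed (auto simp: two_removable_def)

lemma three_star_core_unique:
  assumes "graph G" shows "\<exists>!C. is_core three_star_removable G C"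
proof (rule is_core_ex1[OF assms])
  fix G :: "('a,'b) pre_digraph" and T W
  assume fin: "graph G" and T: "three_star_removable G T"
    and W: "W \<subseteq> verts G" "T \<inter> W \<noteq> {}"
  let ?N = "closed_neighbours G" and ?M = "closed_neighbours (G \<restriction> W)"
  have finN: "finite (?N v)" for v using fin by (simp add: closed_neighbours_def finite_neighbours)
  have MN: "?M v \<subseteq> ?N v \<inter> insert v W" for v
    using neighbours_induce[of G W v] by (auto simp: closed_neighbours_def)
  have one: "\<exists>T'. three_star_removable (G \<restriction> W) T'"
    if "u \<noteq> v" "v \<in> W" "u \<notin> W" "card (?N u \<union> ?N v) \<le> 4" for u v
  proof -
    have "u \<in> ?N u" by (simp add: closed_neighbours_def)
    then have "insert v (neighbours (G \<restriction> W) v) \<subseteq> (?N u \<union> ?N v) - {u}"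
      using MN[of v] that by (auto simp: closed_neighbours_def)
    then have "card (insert v (neighbours (G \<restriction> W) v)) \<le> card ((?N u \<union> ?N v) - {u})"
      using finN by (intro card_mono) auto
    also have "\<dots> < card (?N u \<union> ?N v)"
      using finN \<open>u \<in> ?N u\<close> by (intro card_Diff1_less) auto
    finally have A: "card (insert v (neighbours (G \<restriction> W) v)) \<le> 3" using that by simp
    have "v \<notin> neighbours (G \<restriction> W) v" "finite (neighbours (G \<restriction> W) v)"
      by (rule not_in_neighbours finite_neighbours, rule graph_induce[OF W(1) fin])+
    then have "card (neighbours (G \<restriction> W) v) \<le> 2" using A by simp
    then show ?thesis
      using that(2) unfolding three_star_removable_def induce_subgraph_verts by blast
  qed
  from T show "\<exists>T'. three_star_removable (G \<restriction> W) T'"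
    unfolding three_star_removable_def[of G]
  proof (elim disjE bexE conjE)
    fix v assume "T = {v}" "card (neighbours G v) \<le> 2"
    then show ?thesis
      using W le_trans[OF card_neighbours_induce[OF fin, of W v]]
      unfolding three_star_removable_def induce_subgraph_verts by blast
  next
    fix u v assume uv: "u \<noteq> v" "T = {u, v}" "card (?N u \<union> ?N v) \<le> 4"
    show ?thesis
    proof (cases "u \<in> W \<and> v \<in> W")
      case True
      have "card (?M u \<union> ?M v) \<le> card (?N u \<union> ?N v)"
        using MN[of u] MN[of v] finN by (intro card_mono) auto
      then have "card (?M u \<union> ?M v) \<le> 4" using uv(3) by (rule le_trans)
      then have "three_star_removable (G \<restriction> W) {u, v}"
        using True uv(1) unfolding three_star_removable_def induce_subgraph_verts by blast
      then show ?thesis by blast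
    next
      case False
      then have "u \<notin> W \<and> v \<in> W \<or> v \<notin> W \<and> u \<in> W" using uv(2) W(2) by blast
      then show ?thesis using one[of u v] one[of v u] uv(1,3) by (metis Un_commute)
    qed
  qed
qed (auto simp: three_star_removable_def)

end

theory Submission
  imports Defs
begin

text \<open>If the \<open>3\<^sup>*\<close>-core of \<open>X\<close> has a separation \<open>(A, S, B)\<close> with \<open>|S| = 2\<close>, the removal rules force
  \<open>|A|, |B| \<ge> 3\<close>, so the complement contains the complete bipartite graph between \<open>A\<close> and \<open>B\<close>; this
  makes the \<open>3\<^sup>*\<close>-core of the complement 3-connected and not a clique. Otherwise either case (iv)
  holds or both cores are empty or cliques. Each removed vertex accounts for at most \<open>5/2\<close> edges, so
  for at least 12 vertices counting the edges of both graphs leaves only the case that one core is a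
  clique \<open>C\<close> on at least 9 vertices and the other one is empty. A vertex outside \<open>C\<close> has at most two
  neighbours in \<open>C\<close>, so three such vertices would give a \<open>K\<^sub>3\<^sub>,\<^sub>3\<close> in the complement. Hence at
  most two vertices lie outside \<open>C\<close>, and these cases yield (i), (ii) and (iii).\<close>

section \<open>Stable sets and arc counts\<close>

text \<open>A set is stable if neither of the \<open>3\<^sup>*\<close>-removal rules applies to the subgraph it induces; the
  \<open>3\<^sup>*\<close>-core is induced by the largest stable set.\<close>

definition stable :: "'a rel \<Rightarrow> 'a set \<Rightarrow> bool" where
  "stable E U \<longleftrightarrow> (\<forall>v\<in>U. 3 \<le> card (E `` {v} \<inter> U)) \<and>
     (\<forall>u\<in>U. \<forall>v\<in>U. u \<noteq> v \<longrightarrow> 5 \<le> card ({u, v} \<union> E `` {u, v} \<inter> U))"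

definition largest_stable :: "'a rel \<Rightarrow> 'a set \<Rightarrow> 'a set \<Rightarrow> bool" where
  "largest_stable E V C \<longleftrightarrow> C \<subseteq> V \<and> stable E C \<and> (\<forall>W\<subseteq>V. stable E W \<longrightarrow> W \<subseteq> C)"

text \<open>For symmetric \<open>E\<close>, the sides \<open>A\<close> and \<open>B\<close> are
  unions of components of what remains after deleting \<open>S\<close>; they need not be connected
  themselves.\<close>

definition two_separation :: "'a rel \<Rightarrow> 'a set \<Rightarrow> 'a set \<Rightarrow> 'a set \<Rightarrow> 'a set \<Rightarrow> bool" where
  "two_separation E U A S B \<longleftrightarrow> U = A \<union> S \<union> B \<and> A \<inter> S = {} \<and> A \<inter> B = {} \<and> S \<inter> B = {} \<and>
     card S = 2 \<and> A \<noteq> {} \<and> B \<noteq> {} \<and> E \<inter> A \<times> B = {} \<and> E \<inter> B \<times> A = {}"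

lemma largest_stableD: "largest_stable E V C \<Longrightarrow> stable E W \<Longrightarrow> W \<subseteq> V \<Longrightarrow> W \<subseteq> C"
  by (simp add: largest_stable_def)

lemma two_separation_commute: "two_separation E U A S B \<Longrightarrow> two_separation E U B S A"
  by (auto simp: two_separation_def)

lemma stable_degree: "stable E U \<Longrightarrow> v \<in> U \<Longrightarrow> 3 \<le> card (E `` {v} \<inter> U)"
  by (auto simp: stable_def)

lemma stable_pair:
  "stable E U \<Longrightarrow> u \<in> U \<Longrightarrow> v \<in> U \<Longrightarrow> u \<noteq> v \<Longrightarrow> 5 \<le> card ({u, v} \<union> E `` {u, v} \<inter> U)"
  unfolding stable_def by blast

lemma not_stable_cases:
  assumes "\<not> stable E W"
  obtains (vertex) v where "v \<in> W" "card (E `` {v} \<inter> W) \<le> 2"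
  | (pair) u v where "u \<in> W" "v \<in> W" "u \<noteq> v" "card ({u, v} \<union> E `` {u, v} \<inter> W) \<le> 4"
proof -
  from assms have "(\<exists>v\<in>W. \<not> 3 \<le> card (E `` {v} \<inter> W)) \<or>
      (\<exists>u\<in>W. \<exists>v\<in>W. u \<noteq> v \<and> \<not> 5 \<le> card ({u, v} \<union> E `` {u, v} \<inter> W))"
    unfolding stable_def by blast
  then show thesis
  proof (elim disjE bexE conjE)
    fix v assume "v \<in> W" "\<not> 3 \<le> card (E `` {v} \<inter> W)"
    then show thesis by (intro vertex[of v]) auto
  next
    fix u v assume "u \<in> W" "v \<in> W" "u \<noteq> v" "\<not> 5 \<le> card ({u, v} \<union> E `` {u, v} \<inter> W)"
    then show thesis by (intro pair[of u v]) auto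
  qed
qed

lemma stable_card_ge_5:
  assumes "finite U" "irrefl E" "stable E U" "U \<noteq> {}"
  shows "5 \<le> card U"
proof -
  obtain v where v: "v \<in> U" using assms(4) by auto
  have "E `` {v} \<inter> U \<noteq> {}" using stable_degree[OF assms(3) v] by auto
  then obtain u where u: "u \<in> U" "(v, u) \<in> E" by auto
  then have "u \<noteq> v" using assms(2) by (auto simp: irrefl_def)
  have "card ({u, v} \<union> E `` {u, v} \<inter> U) \<le> card U"
    using u v assms(1) by (intro card_mono) auto
  then show ?thesis using stable_pair[OF assms(3) u(1) v \<open>u \<noteq> v\<close>] by simp
qed

text \<open>Degrees only grow from \<open>C\<close> to \<open>W\<close>, so the vertex rule never
  removes a member of a stable subset; \<open>pair_meets_stable\<close> is the counterpart for
  pairs.\<close>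

lemma vertex_meets_stable:
  assumes "finite W" "C \<subseteq> W" "stable E C" "v \<in> C"
  shows "3 \<le> card (E `` {v} \<inter> W)"
proof -
  have "card (E `` {v} \<inter> C) \<le> card (E `` {v} \<inter> W)"
    using assms by (intro card_mono) auto
  then show ?thesis using stable_degree[OF assms(3,4)] by simp
qed

text \<open>A vertex of \<open>C\<close> and its neighbours in \<open>C\<close> are at least four vertices, and a vertex outside
  \<open>C\<close> is a fifth one.\<close>

lemma pair_meets_stable:
  assumes "finite W" "irrefl E" "C \<subseteq> W" "stable E C" "u \<in> C" "v \<in> W" "u \<noteq> v"
  shows "5 \<le> card ({u, v} \<union> E `` {u, v} \<inter> W)"
proof (cases "v \<in> C")
  case True
  have "card ({u, v} \<union> E `` {u, v} \<inter> C) \<le> card ({u, v} \<union> E `` {u, v} \<inter> W)"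
    using assms by (intro card_mono) auto
  then show ?thesis using stable_pair[OF assms(4,5) True assms(7)] by simp
next
  case False
  have fin: "finite (E `` {u} \<inter> C)" using assms finite_subset by blast
  have "card (insert u (insert v (E `` {u} \<inter> C))) = card (E `` {u} \<inter> C) + 2"
    using False fin assms(2,7) by (auto simp: irrefl_def)
  moreover have "card (insert u (insert v (E `` {u} \<inter> C))) \<le> card ({u, v} \<union> E `` {u, v} \<inter> W)"
    using assms by (intro card_mono) auto
  ultimately show ?thesis using stable_degree[OF assms(4,5)] by simp
qed

text \<open>Two vertices on the same side together with the opposite side make at least 2 + 3
  vertices; two on opposite sides see all of \<open>A \<union> B\<close>, at least 6.\<close>

lemma stable_complete_bipartite:
  assumes "finite A" "finite B" "A \<inter> B = {}" "3 \<le> card A" "3 \<le> card B"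
    and E: "A \<times> B \<subseteq> E" "B \<times> A \<subseteq> E"
  shows "stable E (A \<union> B)"
proof -
  have deg: "3 \<le> card (E `` {v} \<inter> (A \<union> B))" if "v \<in> A \<union> B" for v
  proof -
    have "A \<subseteq> E `` {v} \<inter> (A \<union> B) \<or> B \<subseteq> E `` {v} \<inter> (A \<union> B)" using that E by auto
    then show ?thesis using assms(1,2,4,5) card_mono[of "E `` {v} \<inter> (A \<union> B)"]
      by (metis finite_Int finite_UnI le_trans)
  qed
  have pair: "5 \<le> card ({u, v} \<union> E `` {u, v} \<inter> (A \<union> B))"
    if uv: "u \<in> A \<union> B" "v \<in> A \<union> B" "u \<noteq> v" for u v
  proof -
    consider "u \<in> A \<and> v \<in> A" | "u \<in> B \<and> v \<in> B" | "u \<in> A \<and> v \<in> B \<or> v \<in> A \<and> u \<in> B"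
      using uv by blast
    then show ?thesis
    proof cases
      case 1
      have "card ({u, v} \<union> B) \<le> card ({u, v} \<union> E `` {u, v} \<inter> (A \<union> B))"
        using 1 E assms(1,2) by (intro card_mono) auto
      moreover have "card ({u, v} \<union> B) = card {u, v} + card B"
        using 1 assms(2,3) by (intro card_Un_disjoint) auto
      ultimately show ?thesis using assms(5) uv(3) by simp
    next
      case 2
      have "card ({u, v} \<union> A) \<le> card ({u, v} \<union> E `` {u, v} \<inter> (A \<union> B))"
        using 2 E assms(1,2) by (intro card_mono) auto
      moreover have "card ({u, v} \<union> A) = card {u, v} + card A"
        using 2 assms(1,3) by (intro card_Un_disjoint) auto
      ultimately show ?thesis using assms(4) uv(3) by simp
    next
      case 3
      have "card (A \<union> B) \<le> card ({u, v} \<union> E `` {u, v} \<inter> (A \<union> B))"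
        using 3 E assms(1,2) by (intro card_mono) auto
      moreover have "card (A \<union> B) = card A + card B"
        using assms(1-3) by (intro card_Un_disjoint) auto
      ultimately show ?thesis using assms(4,5) by simp
    qed
  qed
  show ?thesis unfolding stable_def using deg pair by blast
qed

text \<open>Neighbours of \<open>A\<close> stay in \<open>A \<union> S\<close>. The degree of one
  vertex of \<open>A\<close> gives \<open>card A + 1 >= 3\<close>; this supplies a second vertex,
  and the pair condition then gives \<open>card A + 2 >= 5\<close>.\<close>

lemma two_separation_card:
  assumes "finite U" "irrefl E" "stable E U" "two_separation E U A S B"
  shows "3 \<le> card A"
proof -
  have U: "U = A \<union> S \<union> B" "A \<inter> S = {}" "card S = 2" "A \<noteq> {}" "E \<inter> A \<times> B = {}"
    using assms(4) by (auto simp: two_separation_def)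
  have fin: "finite A" "finite S" using assms(1) U(1) by auto
  have AS: "card (A \<union> S) = card A + 2" using U fin by (simp add: card_Un_disjoint)
  obtain a where a: "a \<in> A" using U by auto
  have "E `` {a} \<inter> U \<subseteq> (A \<union> S) - {a}" using a U assms(2) by (auto simp: irrefl_def)
  then have "3 \<le> card ((A \<union> S) - {a})"
    using stable_degree[OF assms(3), of a] a U fin card_mono[of "(A \<union> S) - {a}"]
    by (metis UnI1 finite_Diff finite_UnI le_trans)
  also have "card ((A \<union> S) - {a}) = card A + 1" using a AS by simp
  finally have "2 \<le> card A" by simp
  then have "\<not> A \<subseteq> {a}" using card_mono[of "{a}" A] by auto
  then obtain b where b: "b \<in> A" "a \<noteq> b" by auto
  have "card ({a, b} \<union> E `` {a, b} \<inter> U) \<le> card (A \<union> S)"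
    using a b U fin by (intro card_mono) auto
  moreover have "5 \<le> card ({a, b} \<union> E `` {a, b} \<inter> U)"
    by (rule stable_pair[OF assms(3)]) (use a b U in auto)
  ultimately show ?thesis using AS by simp
qed

section \<open>Counting arcs along the removal process\<close>

text \<open>\<open>M\<close> bounds the neighbours of \<open>T\<close> outside \<open>T\<close>, and
  \<open>D\<close> the arcs inside \<open>T\<close>. The factor 2 is there because every edge is a
  pair of arcs.\<close>

lemma card_arcs_split:
  assumes "finite W" "sym E" "irrefl E" "T \<subseteq> W" "finite M" "finite D"
    and "\<And>t. t \<in> T \<Longrightarrow> E `` {t} \<inter> W \<subseteq> M \<union> T" and "E \<inter> T \<times> T \<subseteq> D"
  shows "card (E \<inter> W \<times> W) \<le> card (E \<inter> (W - T) \<times> (W - T)) + (2 * (card T * card M) + card D)"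
proof -
  have finT: "finite T" using assms finite_subset by blast
  have "E \<inter> W \<times> W \<subseteq> E \<inter> (W - T) \<times> (W - T) \<union> (T \<times> M \<union> M \<times> T \<union> D)"
  proof
    fix p assume "p \<in> E \<inter> W \<times> W"
    then obtain x y where p: "p = (x, y)" "(x, y) \<in> E" "(y, x) \<in> E" "x \<in> W" "y \<in> W"
      using assms(2) by (auto dest: symD)
    have "y \<in> M \<union> T" if "x \<in> T" using assms(7)[OF that] p by auto
    moreover have "x \<in> M \<union> T" if "y \<in> T" using assms(7)[OF that] p by auto
    ultimately show "p \<in> E \<inter> (W - T) \<times> (W - T) \<union> (T \<times> M \<union> M \<times> T \<union> D)"
      using p assms(8) by auto
  qed
  then have "card (E \<inter> W \<times> W) \<le> card (E \<inter> (W - T) \<times> (W - T) \<union> (T \<times> M \<union> M \<times> T \<union> D))"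
    using assms finT by (intro card_mono) auto
  also have "\<dots> \<le> card (E \<inter> (W - T) \<times> (W - T)) + card (T \<times> M \<union> M \<times> T \<union> D)"
    by (rule card_Un_le)
  also have "card (T \<times> M \<union> M \<times> T \<union> D) \<le> card (T \<times> M) + card (M \<times> T) + card D"
    by (meson card_Un_le le_trans add_le_mono1)
  finally show ?thesis by (simp add: card_cartesian_product mult.commute)
qed

text \<open>Five arcs per vertex are 5/2 edges. A single vertex loses at most 4 arcs; a pair with at
  most two outer neighbours loses at most 2 * 2 * 2 arcs to them and 2 inside, which is 5 *
  2.\<close>

lemma removal_arcs:
  assumes fin: "finite W" and E: "sym E" "irrefl E" and C: "C \<subseteq> W" "stable E C"
    and W: "\<not> stable E W"
  obtains T where "T \<subseteq> W - C" "T \<noteq> {}" "card T \<le> 2"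
    "card (E \<inter> W \<times> W) \<le> card (E \<inter> (W - T) \<times> (W - T)) + 5 * card T"
  using W
proof (cases rule: not_stable_cases)
  case (vertex v)
  have "v \<notin> C" using vertex_meets_stable[OF fin C, of v] vertex by auto
  moreover have "card (E \<inter> W \<times> W) \<le> card (E \<inter> (W - {v}) \<times> (W - {v}))
      + (2 * (card {v} * card (E `` {v} \<inter> W)) + card ({} :: ('a \<times> 'a) set))"
    by (rule card_arcs_split) (use fin E vertex in \<open>auto simp: irrefl_def\<close>)
  ultimately show thesis using that[of "{v}"] vertex by auto
next
  case (pair u v)
  have "u \<notin> C" using pair_meets_stable[OF fin E(2) C, of u v] pair by auto
  have "v \<notin> C"
    using pair_meets_stable[OF fin E(2) C, of v u] pair by (auto simp: insert_commute)
  let ?M = "E `` {u, v} \<inter> W - {u, v}"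
  have "{u, v} \<union> E `` {u, v} \<inter> W = {u, v} \<union> ?M" by auto
  moreover have "card ({u, v} \<union> ?M) = card {u, v} + card ?M"
    using fin by (intro card_Un_disjoint) auto
  ultimately have M: "card ?M \<le> 2" using pair by simp
  have "card (E \<inter> W \<times> W) \<le> card (E \<inter> (W - {u, v}) \<times> (W - {u, v}))
      + (2 * (card {u, v} * card ?M) + card {(u, v), (v, u)})"
    by (rule card_arcs_split) (use fin E pair in \<open>auto simp: irrefl_def\<close>)
  also have "\<dots> \<le> card (E \<inter> (W - {u, v}) \<times> (W - {u, v})) + 5 * card {u, v}"
    using pair M by simp
  finally show thesis using that[of "{u, v}"] pair \<open>u \<notin> C\<close> \<open>v \<notin> C\<close> by (simp add: card_insert_if)
qed

lemma largest_stable_not_stable: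
  "largest_stable E V C \<Longrightarrow> C \<subset> W \<Longrightarrow> W \<subseteq> V \<Longrightarrow> \<not> stable E W"
  unfolding largest_stable_def by blast

text \<open>Sets are removed from \<open>W\<close> by \<open>removal_arcs\<close> until only
  \<open>C\<close> is left; each removed set avoids \<open>C\<close>.\<close>

lemma card_arcs_le:
  assumes "finite V" "sym E" "irrefl E" "largest_stable E V C" "C \<subseteq> W" "W \<subseteq> V"
  shows "card (E \<inter> W \<times> W) + 5 * card C \<le> card (E \<inter> C \<times> C) + 5 * card W"
  using assms(5,6)
proof (induction "card W" arbitrary: W rule: less_induct)
  case less
  have fin: "finite W" using less assms(1) finite_subset by blast
  show ?case
  proof (cases "W = C")
    case False
    then have "\<not> stable E W" using largest_stable_not_stable[OF assms(4), of W] less by blast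
    then obtain T where T: "T \<subseteq> W - C" "T \<noteq> {}"
      "card (E \<inter> W \<times> W) \<le> card (E \<inter> (W - T) \<times> (W - T)) + 5 * card T"
      using removal_arcs[OF fin assms(2,3), of C] less assms(4)
      unfolding largest_stable_def by metis
    have finT: "finite T" using T fin by (meson finite_Diff finite_subset)
    have cW: "card (W - T) + card T = card W"
      using T fin finT by (metis Diff_subset card_Diff_subset card_mono le_add_diff_inverse2 subset_trans)
    moreover have "0 < card T" using T finT by (simp add: card_gt_0_iff)
    ultimately have "card (E \<inter> (W - T) \<times> (W - T)) + 5 * card C \<le> card (E \<inter> C \<times> C) + 5 * card (W - T)"
      using less.hyps[of "W - T"] less.prems T by auto
    then show ?thesis using T cW by linarith
  qed simp
qed

lemma card_irrefl_arcs_le: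
  assumes "finite W" "irrefl E"
  shows "card (E \<inter> W \<times> W) + card W \<le> card W * card W"
proof -
  have "card (E \<inter> W \<times> W \<union> (\<lambda>x. (x, x)) ` W) = card (E \<inter> W \<times> W) + card ((\<lambda>x. (x, x)) ` W)"
    using assms by (intro card_Un_disjoint) (auto simp: irrefl_def)
  moreover have "card ((\<lambda>x. (x, x)) ` W) = card W" by (rule card_image) (auto simp: inj_on_def)
  moreover have "card (E \<inter> W \<times> W \<union> (\<lambda>x. (x, x)) ` W) \<le> card (W \<times> W)"
    using assms by (intro card_mono) auto
  ultimately show ?thesis by (simp add: card_cartesian_product)
qed

text \<open>Stopping the removal at two or three vertices gains 8 arcs over
  \<open>card_arcs_le\<close>; this gain excludes a core of size 8 in
  \<open>complete_core_card_ge_9\<close>.\<close>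

lemma card_arcs_le_empty_core:
  assumes "finite V" "sym E" "irrefl E" "largest_stable E V {}" "2 \<le> card W" "W \<subseteq> V"
  shows "card (E \<inter> W \<times> W) + 8 \<le> 5 * card W"
  using assms(5,6)
proof (induction "card W" arbitrary: W rule: less_induct)
  case less
  have fin: "finite W" using less assms(1) finite_subset by blast
  show ?case
  \<comment> \<open>A step removes at most two vertices, so from four or more at least two remain
    and the induction hypothesis applies.\<close>
  proof (cases "card W \<le> 3")
    case True
    then have "card W = 2 \<or> card W = 3" using less by auto
    then show ?thesis using card_irrefl_arcs_le[OF fin assms(3)] by auto
  next
    case False
    then have "W \<noteq> {}" by auto
    then have "\<not> stable E W" using largest_stable_not_stable[OF assms(4), of W] less by blast
    then obtain T where T: "T \<subseteq> W - {}" "T \<noteq> {}" "card T \<le> 2"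
      "card (E \<inter> W \<times> W) \<le> card (E \<inter> (W - T) \<times> (W - T)) + 5 * card T"
      using removal_arcs[OF fin assms(2,3), of "{}"] assms(4)
      unfolding largest_stable_def by (metis empty_subsetI)
    have finT: "finite T" using T fin by (meson finite_Diff finite_subset)
    have cW: "card (W - T) + card T = card W"
      using T fin finT by (metis Diff_subset card_Diff_subset card_mono le_add_diff_inverse2 subset_trans)
    moreover have "0 < card T" using T finT by (simp add: card_gt_0_iff)
    ultimately have "card (E \<inter> (W - T) \<times> (W - T)) + 8 \<le> 5 * card (W - T)"
      using less.hyps[of "W - T"] less.prems T False by auto
    then show ?thesis using T cW by linarith
  qed
qed

text \<open>With three neighbours of \<open>w\<close> in \<open>C\<close>, the set
  \<open>insert w C\<close> would be stable, against maximality: any pair of distinct vertices in it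
  meets \<open>C\<close>, so \<open>pair_meets_stable\<close> applies.\<close>

lemma card_neighbours_in_core:
  assumes fin: "finite V" and E: "sym E" "irrefl E" and C: "largest_stable E V C"
    and w: "w \<in> V - C"
  shows "card (E `` {w} \<inter> C) \<le> 2"
proof (rule ccontr)
  assume w3: "\<not> ?thesis"
  have CV: "C \<subseteq> V" "stable E C" using C by (auto simp: largest_stable_def)
  have finW: "finite (insert w C)" using fin CV finite_subset by auto
  have deg: "E `` {w} \<inter> insert w C = E `` {w} \<inter> C" using E by (auto simp: irrefl_def)
  have "\<not> stable E (insert w C)"
    using largest_stable_not_stable[OF C(1)] w CV by blast
  then show False
  proof (cases rule: not_stable_cases)
    case (vertex v)
    have "v \<noteq> w" using vertex(2) w3 unfolding deg[symmetric] by blast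
    then have "v \<in> C" using vertex(1) by blast
    then show ?thesis
      using vertex_meets_stable[OF finW subset_insertI CV(2), of v] vertex(2) by linarith
  next
    case (pair u v)
    have core: "5 \<le> card ({x, y} \<union> E `` {x, y} \<inter> insert w C)"
      if "x \<in> C" "y \<in> insert w C" "x \<noteq> y" for x y
      by (rule pair_meets_stable[OF finW E(2) subset_insertI CV(2) that])
    have "u \<in> C \<or> v \<in> C" using pair by blast
    then have "5 \<le> card ({u, v} \<union> E `` {u, v} \<inter> insert w C)"
      using core[of u v] core[of v u] pair(1-3) by (metis insert_commute)
    then show ?thesis using pair(4) by linarith
  qed
qed

section \<open>Complementary relations\<close>

abbreviation complete_on :: "'a rel \<Rightarrow> 'a set \<Rightarrow> bool" where
  "complete_on E U \<equiv> \<forall>x\<in>U. \<forall>y\<in>U. x \<noteq> y \<longrightarrow> (x, y) \<in> E"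

text \<open>With \<open>c = card C\<close> and \<open>n = card V\<close> this is the bound
  \<open>c * (c - 1) + 5 * (n - c)\<close> on the arcs, written without subtraction on
  \<open>nat\<close>.\<close>

lemma card_arcs_inside_le:
  assumes "finite V" "sym E" "irrefl E" "E \<subseteq> V \<times> V" "largest_stable E V C"
  shows "card E + 6 * card C \<le> card C * card C + 5 * card V"
proof -
  have C: "C \<subseteq> V" using assms(5) by (simp add: largest_stable_def)
  then have "finite C" using assms(1) finite_subset by blast
  moreover have "E \<inter> V \<times> V = E" using assms(4) by blast
  ultimately show ?thesis
    using card_irrefl_arcs_le[OF _ assms(3), of C] card_arcs_le[OF assms(1-3,5) C order_refl]
    by simp
qed

text \<open>The assumptions are symmetric in \<open>E\<close> and \<open>F\<close>, so
  \<open>swap\<close> transfers every result to the other graph.\<close>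

locale complementary =
  fixes V :: "'a set" and E F :: "'a rel"
  assumes finite_V: "finite V" and sym_E: "sym E" and sym_F: "sym F"
    and union: "E \<union> F = {(x, y). x \<in> V \<and> y \<in> V \<and> x \<noteq> y}" and disjoint: "E \<inter> F = {}"
begin

lemma swap: "complementary V F E"
  using finite_V sym_E sym_F union disjoint by (unfold_locales) auto

lemma E_subset: "E \<subseteq> V \<times> V" and F_subset: "F \<subseteq> V \<times> V"
  and irrefl_E: "irrefl E" and irrefl_F: "irrefl F"
  using union by (auto simp: irrefl_def)

lemma F_iff: "x \<in> V \<Longrightarrow> y \<in> V \<Longrightarrow> x \<noteq> y \<Longrightarrow> (x, y) \<in> F \<longleftrightarrow> (x, y) \<notin> E"
  using union disjoint by blast

lemma card_arcs: "card E + card F + card V = card V * card V"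
proof -
  have fin: "finite E" "finite F"
    using E_subset F_subset finite_V by (meson finite_SigmaI finite_subset)+
  let ?d = "(\<lambda>x. (x, x)) ` V"
  have "card (E \<union> F \<union> ?d) = card (E \<union> F) + card ?d"
    using fin finite_V irrefl_E irrefl_F by (intro card_Un_disjoint) (auto simp: irrefl_def)
  moreover have "card (E \<union> F) = card E + card F"
    using fin disjoint by (intro card_Un_disjoint) auto
  moreover have "card ?d = card V" by (rule card_image) (auto simp: inj_on_def)
  moreover have "E \<union> F \<union> ?d = V \<times> V" unfolding union by auto
  ultimately show ?thesis by (simp add: card_cartesian_product)
qed

section \<open>Cores separated by two vertices\<close>

text \<open>All pairs between \<open>A\<close> and \<open>B\<close> belong to \<open>F\<close>; both
  sides have at least three vertices, so \<open>A \<union> B\<close> is stable for \<open>F\<close>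
  and lies in its largest stable set.\<close>

lemma separated_parts_in_core:
  assumes "largest_stable E V C" "two_separation E C A S B" "largest_stable F V D"
  shows "3 \<le> card A" "3 \<le> card B" "A \<times> B \<subseteq> F" "B \<times> A \<subseteq> F" "A \<union> B \<subseteq> D"
proof -
  have C: "C \<subseteq> V" "stable E C" using assms(1) by (auto simp: largest_stable_def)
  then have fin: "finite C" using finite_V finite_subset by blast
  have sep: "C = A \<union> S \<union> B" "A \<inter> B = {}" "E \<inter> A \<times> B = {}" "E \<inter> B \<times> A = {}"
    using assms(2) by (auto simp: two_separation_def)
  show cards: "3 \<le> card A" "3 \<le> card B"
    using two_separation_card[OF fin irrefl_E C(2)] assms(2) two_separation_commute by blast+
  show F: "A \<times> B \<subseteq> F" "B \<times> A \<subseteq> F" using sep C F_iff by blast+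
  have "stable F (A \<union> B)"
    by (rule stable_complete_bipartite) (use sep fin cards F in auto)
  then show "A \<union> B \<subseteq> D" by (rule largest_stableD[OF assms(3)]) (use sep C in blast)
qed

text \<open>If the core of \<open>E\<close> is separated by \<open>S\<close> into \<open>A\<close> and \<open>B\<close>, then the core \<open>D\<close> of \<open>F\<close> contains
  the complete bipartite graph between \<open>A\<close> and \<open>B\<close>, which no two vertices separate. A side \<open>B'\<close> of
  a separation of \<open>D\<close> that avoids \<open>A\<close> and \<open>B\<close> would lie in \<open>C\<close>, hence in \<open>S\<close>, which is too small.\<close>

lemma no_separation_of_both_cores:
  assumes C: "largest_stable E V C" "two_separation E C A S B"
    and D: "largest_stable F V D" "two_separation F D A' S' B'"
  shows False
proof -
  note 1 = separated_parts_in_core[OF C D(1)]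
  \<comment> \<open>The sides \<open>A'\<close> and \<open>B'\<close> are interchangeable, so a
    vertex of \<open>A\<close> in \<open>A'\<close> may be assumed. Its \<open>F\<close>-neighbours
    include \<open>B\<close>, which forces \<open>B\<close> into \<open>A' \<union> S'\<close>; a
    vertex of \<open>B\<close> outside \<open>S'\<close> then forces \<open>A\<close> there as
    well.\<close>
  have key: False if sep: "two_separation F D A' S' B'" and a: "a \<in> A \<inter> A'" for A' B' a
  proof -
    note 2 = complementary.separated_parts_in_core[OF swap D(1) sep C(1)]
    have sep': "D = A' \<union> S' \<union> B'" "A' \<inter> S' = {}" "A' \<inter> B' = {}" "S' \<inter> B' = {}" "card S' = 2"
      "F \<inter> A' \<times> B' = {}"
      using sep by (auto simp: two_separation_def)
    have fS: "finite S'" using sep'(5) card.infinite by fastforce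
    have "B \<subseteq> A' \<union> S'" using a 1 sep' by blast
    moreover have "\<not> B \<subseteq> S'" using card_mono[OF fS, of B] sep'(5) 1(2) by auto
    ultimately obtain b where b: "b \<in> B" "b \<in> A'" by blast
    have "A \<subseteq> A' \<union> S'" using b 1 sep' by blast
    then have "(A \<union> B) \<inter> B' = {}" using \<open>B \<subseteq> A' \<union> S'\<close> sep' by blast
    moreover have "B' \<subseteq> C" "C = A \<union> S \<union> B" "card S = 2"
      using 2 C by (auto simp: two_separation_def)
    ultimately have "B' \<subseteq> S" "card S = 2" by auto
    then show False using 2(2) card_mono[of S B'] card.infinite[of S] by fastforce
  qed
  have "D = A' \<union> S' \<union> B'" "card S' = 2" using D by (auto simp: two_separation_def)
  moreover have "\<not> A \<subseteq> S'"
    using card_mono[of S' A] card.infinite[of S'] \<open>card S' = 2\<close> 1(1) by fastforce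
  ultimately obtain a where "a \<in> A" "a \<in> A' \<or> a \<in> B'" using 1(5) by blast
  then show False using key[OF D(2)] key[OF two_separation_commute[OF D(2)]] by blast
qed

text \<open>If \<open>D\<close> were complete in \<open>F\<close>, then \<open>A\<close> would be
  independent in \<open>E\<close>, and a vertex of \<open>A\<close> would have all its neighbours in
  the core \<open>C\<close> among the two vertices of \<open>S\<close>.\<close>

lemma separated_core_complement_not_complete:
  assumes "largest_stable E V C" "two_separation E C A S B" "largest_stable F V D"
  shows "\<not> complete_on F D"
proof
  assume cl: "complete_on F D"
  note 1 = separated_parts_in_core[OF assms]
  have C: "stable E C" using assms(1) by (auto simp: largest_stable_def)
  have sep: "C = A \<union> S \<union> B" "card S = 2" "E \<inter> A \<times> B = {}"
    using assms(2) by (auto simp: two_separation_def)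
  obtain a where a: "a \<in> A" using 1(1) by fastforce
  have "(x, y) \<notin> E" if "x \<in> A" "y \<in> A" for x y
  proof (cases "x = y")
    case False
    have "x \<in> D" "y \<in> D" using that 1(5) by blast+
    then have "(x, y) \<in> F" using cl False by simp
    then show ?thesis using disjoint by blast
  qed (use irrefl_E in \<open>simp add: irrefl_def\<close>)
  then have "E `` {a} \<inter> C \<subseteq> S" using a sep by blast
  then have "card (E `` {a} \<inter> C) \<le> 2"
    using sep(2) card_mono[of S "E `` {a} \<inter> C"] card.infinite[of S] by fastforce
  then show False using stable_degree[OF C, of a] a sep(1) by auto
qed

section \<open>Counting the arcs of both graphs\<close>

text \<open>Otherwise \<open>n = card V\<close> would satisfy \<open>n * (n - 1) <= 10 * n\<close>,
  hence \<open>n <= 11\<close>.\<close>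

lemma cores_not_both_empty:
  assumes "largest_stable E V {}" "largest_stable F V {}"
  shows "card V < 12"
proof (rule ccontr)
  assume n: "\<not> ?thesis"
  have "E \<inter> V \<times> V = E" "F \<inter> V \<times> V = F" using E_subset F_subset by blast+
  then have "card E + 8 \<le> 5 * card V" "card F + 8 \<le> 5 * card V"
    using card_arcs_le_empty_core[OF finite_V sym_E irrefl_E assms(1), of V]
      card_arcs_le_empty_core[OF finite_V sym_F irrefl_F assms(2), of V] n by auto
  then have "card V * card V \<le> 11 * card V" using card_arcs by linarith
  then show False using n by auto
qed

lemma card_arcs_between_le:
  assumes "largest_stable E V C" "W \<subseteq> V"
  shows "card (E \<inter> (W - C) \<times> C) \<le> 2 * card (W - C)"
proof -
  have fin: "finite C" "finite (W - C)"
    using assms finite_V finite_subset by (auto simp: largest_stable_def)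
  have "E \<inter> (W - C) \<times> C \<subseteq> (SIGMA w:W - C. E `` {w} \<inter> C)" by auto
  then have "card (E \<inter> (W - C) \<times> C) \<le> card (SIGMA w:W - C. E `` {w} \<inter> C)"
    using fin by (intro card_mono) auto
  also have "\<dots> = (\<Sum>w\<in>W - C. card (E `` {w} \<inter> C))" using fin by simp
  also have "\<dots> \<le> (\<Sum>w\<in>W - C. 2)"
    using assms(2) by (intro sum_mono card_neighbours_in_core[OF finite_V sym_E irrefl_E assms(1)]) auto
  finally show ?thesis by (simp add: mult.commute)
qed

text \<open>With \<open>a\<close> and \<open>b\<close> the sizes of \<open>C - D\<close> and \<open>D - C\<close>, counting the pairs between these sets
  gives \<open>a b \<le> 2 a + 2 b\<close>. As \<open>C\<close> and \<open>D\<close> share at most one vertex, this forces \<open>a = b = 4\<close>.\<close>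

lemma complete_cores_card:
  assumes C: "largest_stable E V C" "C \<noteq> {}" "complete_on E C"
    and D: "largest_stable F V D" "D \<noteq> {}" "complete_on F D"
  shows "card C = 5 \<and> card D = 5"
proof -
  have sub: "C \<subseteq> V" "stable E C" "D \<subseteq> V" "stable F D"
    using C(1) D(1) by (simp_all add: largest_stable_def)
  have fin: "finite C" "finite D" using sub finite_V finite_subset by blast+
  have ge: "5 \<le> card C" "5 \<le> card D"
    using stable_card_ge_5[OF fin(1) irrefl_E sub(2) C(2)]
      stable_card_ge_5[OF fin(2) irrefl_F sub(4) D(2)] by auto
  define a b i where "a = card (C - D)" and "b = card (D - C)" and "i = card (C \<inter> D)"
  have "x = y" if "x \<in> C \<inter> D" "y \<in> C \<inter> D" for x y
    using that C(3) D(3) disjoint by blast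
  then have i: "i \<le> 1" unfolding i_def using fin by (auto simp: card_le_Suc0_iff_eq)
  have cards: "card C = a + i" "card D = b + i"
    unfolding a_def b_def i_def using fin card_Int_Diff[of C D] card_Int_Diff[of D C]
    by (auto simp: Int_commute)
  \<comment> \<open>Each such pair is an arc of \<open>F\<close> or, reversed, one of
    \<open>E\<close>. The reversal makes the arc start outside \<open>C\<close>, as
    \<open>card_arcs_between_le\<close> requires.\<close>
  have "(C - D) \<times> (D - C) \<subseteq> prod.swap ` (E \<inter> (D - C) \<times> C) \<union> F \<inter> (C - D) \<times> D"
  proof
    fix p assume "p \<in> (C - D) \<times> (D - C)"
    then obtain x y where p: "p = (x, y)" "x \<in> C - D" "y \<in> D - C" by blast
    then have "(x, y) \<in> F \<or> (y, x) \<in> E"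
      using F_iff[of x y] sub sym_E by (auto dest: symD)
    then show "p \<in> prod.swap ` (E \<inter> (D - C) \<times> C) \<union> F \<inter> (C - D) \<times> D"
      using p by (auto intro!: image_eqI[of _ _ "(y, x)"])
  qed
  then have "card ((C - D) \<times> (D - C)) \<le> card (prod.swap ` (E \<inter> (D - C) \<times> C) \<union> F \<inter> (C - D) \<times> D)"
    using fin by (intro card_mono) auto
  also have "\<dots> \<le> card (E \<inter> (D - C) \<times> C) + card (F \<inter> (C - D) \<times> D)"
    using fin by (intro le_trans[OF card_Un_le] add_mono card_image_le) auto
  also have "\<dots> \<le> 2 * b + 2 * a"
    unfolding a_def b_def using sub
    by (intro add_mono card_arcs_between_le[OF C(1)]
      complementary.card_arcs_between_le[OF swap D(1)])
  finally have ab: "a * b \<le> 2 * b + 2 * a"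
    by (simp add: card_cartesian_product a_def b_def)
  have "4 \<le> a" "4 \<le> b" using ge cards i by auto
  \<comment> \<open>The excesses over 4 turn the inequality into
    \<open>16 + 4 * x + 4 * y + x * y <= 16 + 2 * x + 2 * y\<close>.\<close>
  then obtain x y where xy: "a = 4 + x" "b = 4 + y" by (metis le_iff_add)
  then have "x = 0" "y = 0" using ab by (auto simp: algebra_simps)
  then show ?thesis using cards i ge xy by auto
qed

text \<open>For a core of size 5, \<open>card_arcs_inside_le\<close> leaves at most
  \<open>5 * card V - 5\<close> arcs in each graph, too few for 12 vertices.\<close>

lemma cores_not_both_complete:
  assumes "largest_stable E V C" "C \<noteq> {}" "complete_on E C"
    and "largest_stable F V D" "D \<noteq> {}" "complete_on F D"
  shows "card V < 12"
proof (rule ccontr)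
  assume n: "\<not> ?thesis"
  have "card C = 5" "card D = 5" using complete_cores_card[OF assms] by auto
  then have "card E + card F + 10 \<le> 10 * card V"
    using card_arcs_inside_le[OF finite_V sym_E irrefl_E E_subset assms(1)]
      card_arcs_inside_le[OF finite_V sym_F irrefl_F F_subset assms(4)] by simp
  then have "card V * card V \<le> 11 * card V" using card_arcs by linarith
  then show False using n by auto
qed

text \<open>With \<open>c = card C\<close> and \<open>n = card V\<close>, the arc bounds give
  \<open>n * (n - 11) + 8 <= c * (c - 6)\<close>. The left side is at least 20 for
  \<open>n >= 12\<close>, the right side at most 16 for \<open>c\<close> from 5 to 8.\<close>

lemma complete_core_card_ge_9:
  assumes "largest_stable E V C" "C \<noteq> {}" "largest_stable F V {}" "12 \<le> card V"
  shows "9 \<le> card C"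
proof (rule ccontr)
  assume small: "\<not> ?thesis"
  have C: "C \<subseteq> V" "stable E C" using assms by (auto simp: largest_stable_def)
  have "F \<inter> V \<times> V = F" using F_subset by blast
  then have "card F + 8 \<le> 5 * card V"
    using card_arcs_le_empty_core[OF finite_V sym_F irrefl_F assms(3), of V] assms(4) by auto
  then have "card V * card V + 6 * card C + 8 \<le> card C * card C + 11 * card V"
    using card_arcs_inside_le[OF finite_V sym_E irrefl_E E_subset assms(1)] card_arcs by linarith
  moreover have "12 * card V \<le> card V * card V" using assms(4) by simp
  moreover have "5 \<le> card C"
    using stable_card_ge_5[OF finite_subset[OF C(1) finite_V] irrefl_E C(2) assms(2)] .
  then have "card C \<in> {5, 6, 7, 8}" using small by auto
  then have "card C * card C \<le> 6 * card C + 16" by auto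
  ultimately show False using assms(4) by linarith
qed

section \<open>Vertices outside a large core\<close>

text \<open>The vertices of \<open>C\<close> not reached from \<open>W\<close> by an arc of
  \<open>E\<close> are exactly those joined in \<open>F\<close> to all of \<open>W\<close>; each
  member of \<open>W\<close> excludes at most two.\<close>

lemma card_core_minus_neighbours:
  assumes "largest_stable E V C" "W \<subseteq> V - C"
  shows "card C \<le> card (C - E `` W) + 2 * card W"
proof -
  have fin: "finite C" "finite W"
    using assms finite_V finite_subset by (auto simp: largest_stable_def)
  have "E `` W \<inter> C = (\<Union>w\<in>W. E `` {w} \<inter> C)" by auto
  then have "card (E `` W \<inter> C) \<le> (\<Sum>w\<in>W. card (E `` {w} \<inter> C))"
    using card_UN_le[OF fin(2), of "\<lambda>w. E `` {w} \<inter> C"] by (metis (no_types, lifting))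
  also have "\<dots> \<le> (\<Sum>w\<in>W. 2)"
    using assms(2) by (intro sum_mono card_neighbours_in_core[OF finite_V sym_E irrefl_E assms(1)]) auto
  finally have "card (E `` W \<inter> C) \<le> 2 * card W" by (simp add: mult.commute)
  then show ?thesis using card_Int_Diff[OF fin(1), of "E `` W"] by (simp add: Int_commute)
qed

text \<open>Three outside vertices exclude at most 6 of the 9 or more vertices of \<open>C\<close>.
  The 3 that remain form with them a complete bipartite graph in \<open>F\<close>, which is
  stable.\<close>

lemma few_vertices_outside_core:
  assumes C: "largest_stable E V C" "9 \<le> card C" and D: "largest_stable F V {}"
  shows "card (V - C) \<le> 2"
proof (rule ccontr)
  assume "\<not> ?thesis"
  then obtain W where W: "W \<subseteq> V - C" "card W = 3"
    using obtain_subset_with_card_n[of 3 "V - C"] by auto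
  have CV: "C \<subseteq> V" using C(1) by (simp add: largest_stable_def)
  let ?A = "C - E `` W"
  have A: "3 \<le> card ?A" using card_core_minus_neighbours[OF C(1) W(1)] W C(2) by simp
  have WA: "W \<times> ?A \<subseteq> F" using W CV F_iff by blast
  moreover have "?A \<times> W \<subseteq> F" using WA sym_F by (auto dest: symD)
  moreover have "finite W" "finite ?A"
    using W(1) CV finite_V by (meson Diff_subset finite_subset subset_trans)+
  ultimately have "stable F (W \<union> ?A)"
    using W A by (intro stable_complete_bipartite) auto
  then have "W \<union> ?A \<subseteq> {}" by (rule largest_stableD[OF D]) (use W CV in blast)
  then show False using W by auto
qed

end

text \<open>Here \<open>C\<close> is the vertex set of the \<open>3\<^sup>*\<close>-core.\<close>

definition favourable :: "'a rel \<Rightarrow> 'a set \<Rightarrow> 'a set \<Rightarrow> bool" where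
  "favourable E V C \<longleftrightarrow> complete_on E V
    \<or> (\<exists>w\<in>V. E \<subseteq> {w} \<times> V \<union> V \<times> {w} \<and> 2 \<le> card (E `` {w}))
    \<or> (\<exists>u\<in>V. \<exists>v\<in>V. u \<noteq> v \<and> E \<subseteq> {u, v} \<times> V \<union> V \<times> {u, v} \<and> 3 \<le> card (E `` {u} \<inter> E `` {v}))
    \<or> (5 \<le> card C \<and> (\<nexists>A S B. two_separation E C A S B) \<and> \<not> complete_on E C)"

lemma
  shows favourable_complete: "complete_on E V \<Longrightarrow> favourable E V C"
    and favourable_star:
      "\<lbrakk>w \<in> V; E \<subseteq> {w} \<times> V \<union> V \<times> {w}; 2 \<le> card (E `` {w})\<rbrakk> \<Longrightarrow> favourable E V C"
    and favourable_double_star: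
      "\<lbrakk>u \<in> V; v \<in> V; u \<noteq> v; E \<subseteq> {u, v} \<times> V \<union> V \<times> {u, v}; 3 \<le> card (E `` {u} \<inter> E `` {v})\<rbrakk>
        \<Longrightarrow> favourable E V C"
    and favourable_core:
      "\<lbrakk>5 \<le> card C; \<nexists>A S B. two_separation E C A S B; \<not> complete_on E C\<rbrakk> \<Longrightarrow> favourable E V C"
  unfolding favourable_def by (metis | blast)+

context complementary
begin

text \<open>As \<open>C\<close> is independent in \<open>F\<close>, the vertices outside
  \<open>C\<close> cover all arcs of \<open>F\<close>. With none of them \<open>E\<close> is
  complete, with one \<open>F\<close> is a star, and with two every arc of \<open>F\<close> meets
  one of these two.\<close>

lemma complete_core_favourable:
  assumes C: "largest_stable E V C" "C \<noteq> {}" "complete_on E C"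
    and D: "largest_stable F V {}" and n: "12 \<le> card V"
  shows "favourable E V C \<or> favourable F V {}"
proof -
  have CV: "C \<subseteq> V" using C(1) by (simp add: largest_stable_def)
  have FC: "F \<inter> C \<times> C = {}"
  proof -
    have "(x, y) \<notin> F" if "x \<in> C" "y \<in> C" for x y
      using that C(3) disjoint irrefl_F by (cases "x = y") (auto simp: irrefl_def)
    then show ?thesis by blast
  qed
  have C9: "9 \<le> card C" using complete_core_card_ge_9[OF C(1,2) D n] .
  have "card (V - C) \<in> {0, 1, 2}" using few_vertices_outside_core[OF C(1) C9 D] by auto
  then consider "V = C" | w where "V - C = {w}" | u v where "V - C = {u, v}" "u \<noteq> v"
    using CV finite_V by (auto simp: card_1_singleton_iff card_2_iff)
  then show ?thesis
  proof cases
    case 1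
    then show ?thesis using C(3) favourable_complete by metis
  next
    case (2 w)
    have "F \<subseteq> {w} \<times> V \<union> V \<times> {w}" using F_subset FC 2 by blast
    moreover have "C - E `` {w} \<subseteq> F `` {w}" using F_iff 2 CV by blast
    then have "card (C - E `` {w}) \<le> card (F `` {w})"
      using F_subset finite_V by (intro card_mono finite_subset[of "F `` {w}" V]) auto
    then have "2 \<le> card (F `` {w})"
      using card_core_minus_neighbours[OF C(1), of "{w}"] 2 C9 by simp
    ultimately show ?thesis using 2 favourable_star[of w V F] by blast
  next
    case (3 u v)
    have "F \<subseteq> {u, v} \<times> V \<union> V \<times> {u, v}" using F_subset FC 3 by blast
    moreover have "C - E `` {u, v} \<subseteq> F `` {u} \<inter> F `` {v}" using F_iff 3 CV by blast
    then have "card (C - E `` {u, v}) \<le> card (F `` {u} \<inter> F `` {v})"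
      using F_subset finite_V by (intro card_mono finite_subset[of "F `` {u} \<inter> F `` {v}" V]) auto
    then have "3 \<le> card (F `` {u} \<inter> F `` {v})"
      using card_core_minus_neighbours[OF C(1), of "{u, v}"] 3 C9 by simp
    ultimately show ?thesis using 3 favourable_double_star[of u V v F] by blast
  qed
qed

text \<open>A separation of one core puts the other graph into case (iv).\<close>

lemma separated_core_favourable:
  assumes "largest_stable E V C" "two_separation E C A S B" "largest_stable F V D"
  shows "favourable F V D"
proof -
  have D: "D \<subseteq> V" "stable F D" using assms(3) by (auto simp: largest_stable_def)
  have "A \<noteq> {}" using assms(2) by (simp add: two_separation_def)
  then have "D \<noteq> {}" using separated_parts_in_core(5)[OF assms] by blast
  then have "5 \<le> card D"
    using stable_card_ge_5[OF finite_subset[OF D(1) finite_V] irrefl_F D(2)] by blast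
  then show ?thesis
    using no_separation_of_both_cores[OF assms] separated_core_complement_not_complete[OF assms]
    by (intro favourable_core) blast+
qed

theorem favourable:
  assumes C: "largest_stable E V C" and D: "largest_stable F V D" and n: "12 \<le> card V"
  shows "favourable E V C \<or> favourable F V D"
proof (rule ccontr)
  assume bad: "\<not> ?thesis"
  note swapped = complementary.separated_core_favourable[OF swap]
    complementary.complete_core_favourable[OF swap]
  have sub: "C \<subseteq> V" "stable E C" "D \<subseteq> V" "stable F D"
    using C(1) D(1) by (auto simp: largest_stable_def)
  have "\<nexists>A S B. two_separation E C A S B" "\<nexists>A S B. two_separation F D A S B"
    using bad separated_core_favourable[OF C _ D] swapped(1)[OF D _ C] by blast+
  moreover have "5 \<le> card C" if "C \<noteq> {}"
    using stable_card_ge_5[OF finite_subset[OF sub(1) finite_V] irrefl_E sub(2) that] .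
  moreover have "5 \<le> card D" if "D \<noteq> {}"
    using stable_card_ge_5[OF finite_subset[OF sub(3) finite_V] irrefl_F sub(4) that] .
  \<comment> \<open>A nonempty core that is not complete would now be favourable; the empty core is
    complete vacuously.\<close>
  ultimately have complete: "complete_on E C" "complete_on F D"
    using bad favourable_core[of C E V] favourable_core[of D F V]
    by (metis empty_iff)+
  show False
  proof (cases "C = {}"; cases "D = {}")
    assume "C = {}" "D = {}"
    then show False using cores_not_both_empty C D n by simp
  next
    assume "C = {}" "D \<noteq> {}"
    then show False using swapped(2)[OF D _ complete(2)] C n bad by blast
  next
    assume "C \<noteq> {}" "D = {}"
    then show False using complete_core_favourable[OF C _ complete(1)] D n bad by blast
  next
    assume "C \<noteq> {}" "D \<noteq> {}"
    then show False using cores_not_both_complete[OF C _ complete(1) D _ complete(2)] n by simp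
  qed
qed

end

section \<open>Cores of graphs\<close>

text \<open>By \<open>closed\<close>, a removed set misses every \<open>W\<close> to which no rule
  applies, so each such \<open>W\<close> survives all steps. The vertex set of the core is itself
  such a set.\<close>

lemma is_core_largest:
  assumes "graph G" "is_core R G C"
    and closed: "\<And>V T W. \<lbrakk>V \<subseteq> verts G; R (G \<restriction> V) T; W \<subseteq> V; \<nexists>T'. R (G \<restriction> W) T'\<rbrakk> \<Longrightarrow> T \<inter> W = {}"
  obtains U where "U \<subseteq> verts G" "C = G \<restriction> U" "\<nexists>T. R (G \<restriction> U) T"
    "\<And>W. W \<subseteq> verts G \<Longrightarrow> \<nexists>T. R (G \<restriction> W) T \<Longrightarrow> W \<subseteq> U"
proof -
  have "(removal_step R)\<^sup>*\<^sup>* G C" using assms(2) by (simp add: is_core_def)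
  then have "\<exists>U\<subseteq>verts G. C = G \<restriction> U \<and> (\<forall>W\<subseteq>verts G. (\<nexists>T. R (G \<restriction> W) T) \<longrightarrow> W \<subseteq> U)"
  proof (induction rule: rtranclp_induct)
    case base
    then show ?case using induce_verts[OF graph_wf[OF assms(1)]] by (metis order_refl)
  next
    case (step B D)
    then obtain U where U: "U \<subseteq> verts G" "B = G \<restriction> U"
      "\<And>W. W \<subseteq> verts G \<Longrightarrow> \<nexists>T. R (G \<restriction> W) T \<Longrightarrow> W \<subseteq> U" by blast
    from step(2) obtain T where T: "R B T" "D = B \<restriction> (verts B - T)" by cases
    have "W \<subseteq> U - T" if "W \<subseteq> verts G" "\<nexists>T. R (G \<restriction> W) T" for W
      using U(3)[OF that] closed[of U T W] U that T by blast
    moreover have "D = G \<restriction> (U - T)" using T U by (auto simp: induce_induce)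
    ultimately show ?case using U(1) by (metis Diff_subset subset_trans)
  qed
  then show thesis using that assms(2) unfolding is_core_def by blast
qed

lemma neighbours_induce_pair:
  "v \<in> U \<Longrightarrow> neighbours (with_proj H \<restriction> U) v = parcs H `` {v} \<inter> U"
  by (auto simp: neighbours_def arcs_ends_conv image_iff)

lemma arcs_ends_induce_pair: "arcs_ends (with_proj H \<restriction> U) = parcs H \<inter> U \<times> U"
  by (auto simp: arcs_ends_conv image_iff)

lemma closed_neighbours_induce_pair:
  assumes "u \<in> U" "v \<in> U"
  shows "closed_neighbours (with_proj H \<restriction> U) u \<union> closed_neighbours (with_proj H \<restriction> U) v
    = {u, v} \<union> parcs H `` {u, v} \<inter> U"
  using assms by (auto simp: closed_neighbours_def neighbours_induce_pair)

lemma three_star_removable_induce_pair: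
  "three_star_removable (with_proj H \<restriction> U) T \<longleftrightarrow>
     (\<exists>v\<in>U. T = {v} \<and> card (parcs H `` {v} \<inter> U) \<le> 2) \<or>
     (\<exists>u\<in>U. \<exists>v\<in>U. u \<noteq> v \<and> T = {u, v} \<and> card ({u, v} \<union> parcs H `` {u, v} \<inter> U) \<le> 4)"
  unfolding three_star_removable_def induce_subgraph_verts
  by (simp only: neighbours_induce_pair closed_neighbours_induce_pair cong: bex_cong)

lemma stable_iff_not_removable:
  "stable (parcs H) U \<longleftrightarrow> (\<nexists>T. three_star_removable (with_proj H \<restriction> U) T)"
  unfolding stable_def three_star_removable_induce_pair
  by (simp add: not_le Suc_le_eq[symmetric] eval_nat_numeral) blast

lemma pair_graph_facts:
  assumes "pair_graph H"
  shows "graph (with_proj H)" "finite (pverts H)" "parcs H \<subseteq> pverts H \<times> pverts H"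
    "sym (parcs H)" "irrefl (parcs H)"
proof -
  interpret pair_graph H by fact
  show "graph (with_proj H)" by unfold_locales
  show "finite (pverts H)" "parcs H \<subseteq> pverts H \<times> pverts H" by (auto dest: in_arcsD1 in_arcsD2)
  show "sym (parcs H)" using sym_arcs by (simp add: symmetric_def)
  show "irrefl (parcs H)" using no_loops' by (auto simp: irrefl_def)
qed

lemma three_star_core_largest_stable:
  assumes "pair_graph H"
  obtains C where "largest_stable (parcs H) (pverts H) C"
    "three_star_core (with_proj H) = with_proj H \<restriction> C"
proof -
  note H = pair_graph_facts[OF assms]
  have core: "is_core three_star_removable (with_proj H) (three_star_core (with_proj H))"
    unfolding three_star_core_def by (rule theI'[OF three_star_core_unique[OF H(1)]])
  show thesis
  proof (rule is_core_largest[OF H(1) core])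
    fix V T W
    assume V: "V \<subseteq> verts (with_proj H)" and T: "three_star_removable (with_proj H \<restriction> V) T"
      and W: "W \<subseteq> V" "\<nexists>T'. three_star_removable (with_proj H \<restriction> W) T'"
    show "T \<inter> W = {}"
    proof -
      have fin: "finite V" using V H finite_subset by auto
      have st: "stable (parcs H) W" using W(2) stable_iff_not_removable by blast
      from T show ?thesis
        unfolding three_star_removable_induce_pair
      proof (elim disjE bexE conjE)
        fix v assume "v \<in> V" "T = {v}" "card (parcs H `` {v} \<inter> V) \<le> 2"
        then show ?thesis using vertex_meets_stable[OF fin W(1) st, of v] by auto
      next
        fix u v assume uv: "u \<in> V" "v \<in> V" "u \<noteq> v" "T = {u, v}"
          "card ({u, v} \<union> parcs H `` {u, v} \<inter> V) \<le> 4"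
        then have "u \<notin> W" using pair_meets_stable[OF fin H(5) W(1) st, of u v] by auto
        moreover have "v \<notin> W"
          using uv pair_meets_stable[OF fin H(5) W(1) st, of v u] by (auto simp: insert_commute)
        ultimately show ?thesis using uv by auto
      qed
    qed
  next
    fix C
    assume C: "C \<subseteq> verts (with_proj H)" "three_star_core (with_proj H) = with_proj H \<restriction> C"
      "\<nexists>T. three_star_removable (with_proj H \<restriction> C) T"
      "\<And>W. W \<subseteq> verts (with_proj H) \<Longrightarrow> \<nexists>T. three_star_removable (with_proj H \<restriction> W) T \<Longrightarrow> W \<subseteq> C"
    have "largest_stable (parcs H) (pverts H) C"
      unfolding largest_stable_def using C stable_iff_not_removable[of H] by simp
    then show thesis using C(2) that by blast
  qed
qed

section \<open>Cliques and 3-connectedness of induced subgraphs\<close>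

lemma clique_induce_iff:
  assumes "pair_graph H" "U \<subseteq> pverts H"
  shows "clique (with_proj H \<restriction> U) \<longleftrightarrow> complete_on (parcs H) U"
proof -
  note H = pair_graph_facts[OF assms(1)]
  have "graph (with_proj H \<restriction> U)" using graph_induce[of U "with_proj H"] assms(2) H by simp
  then have "clique (with_proj H \<restriction> U) \<longleftrightarrow>
      parcs H \<inter> U \<times> U = {(u, v). (u, v) \<in> U \<times> U \<and> u \<noteq> v}"
    by (simp add: clique_def complete_digraph_def arcs_ends_induce_pair)
  then show ?thesis using H(5) by (auto simp: irrefl_def)
qed

text \<open>If deleting \<open>S\<close> leaves some \<open>v\<close> unreachable from
  \<open>u\<close>, the vertices reachable from \<open>u\<close> form one side of a
  separation.\<close>

lemma k_connected_3_induce: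
  assumes H: "pair_graph H" and U: "4 \<le> card U"
    and sep: "\<nexists>A S B. two_separation (parcs H) U A S B"
  shows "k_connected 3 (with_proj H \<restriction> U)"
proof -
  note H = pair_graph_facts[OF H]
  have fin: "finite U" using U card.infinite by fastforce
  have "connected ((with_proj H \<restriction> U) \<restriction> (U - S))" if S: "S \<subseteq> U" "card S = 2" for S
  proof (rule ccontr)
    assume dis: "\<not> ?thesis"
    \<comment> \<open>\<open>connected\<close> is strong connectedness of this symmetric closure,
      which adds no arcs because \<open>parcs H\<close> is symmetric.\<close>
    let ?M = "mk_symmetric ((with_proj H \<restriction> U) \<restriction> (U - S))"
    have M: "pverts ?M = U - S" "parcs ?M = parcs H \<inter> (U - S) \<times> (U - S)"
      using H(4) by (auto simp: parcs_mk_symmetric dest: symD)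
    \<comment> \<open>\<open>connected\<close> fails for the empty graph, so this way of failing has
      to be excluded first.\<close>
    have "U - S \<noteq> {}" using S U card_mono[of S U] card.infinite[of S] by fastforce
    with dis obtain u v where uv: "u \<in> U - S" "v \<in> U - S" "\<not> u \<rightarrow>\<^sup>*\<^bsub>with_proj ?M\<^esub> v"
      unfolding connected_def strongly_connected_def by (auto simp: M)
    define A where "A = {x. u \<rightarrow>\<^sup>*\<^bsub>with_proj ?M\<^esub> x}"
    have wf: "wf_digraph (with_proj ?M)"
      by unfold_locales (auto simp: M)
    have "A \<subseteq> U - S" using wf_digraph.reachable_in_verts(2)[OF wf] by (auto simp: A_def M)
    moreover have "u \<in> A" using uv wf_digraph.reachable_refl[OF wf, of u] by (simp add: A_def M)
    moreover have "v \<notin> A" using uv by (simp add: A_def)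
    moreover have "y \<in> A" if "x \<in> A" "y \<in> U - S" "(x, y) \<in> parcs H" for x y
    proof -
      have "x \<in> U - S" using that \<open>A \<subseteq> U - S\<close> by blast
      then have "x \<rightarrow>\<^bsub>with_proj ?M\<^esub> y" using that by (simp add: M)
      then show ?thesis using that wf_digraph.reachable_adj_trans[OF wf] by (auto simp: A_def)
    qed
    ultimately have "two_separation (parcs H) U A S (U - S - A)"
      using uv S H(4) unfolding two_separation_def by (auto dest: symD)
    then show False using sep by blast
  qed
  then show ?thesis using U by (auto simp: k_connected_def)
qed

section \<open>Stars\<close>

text \<open>The first three arcs of a long cycle would all contain \<open>w\<close>. But of the two
  ends of the second arc, \<open>fst b\<close> is not on the third arc and \<open>fst c\<close> is
  not on the first.\<close>

lemma star_forest:
  fixes H :: "'a pair_pre_digraph"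
  assumes "parcs H \<subseteq> {w} \<times> V \<union> V \<times> {w}"
  shows "undirected_forest (with_proj H)"
  unfolding undirected_forest_def
proof (intro notI, elim exE conjE)
  fix p assume p: "pre_digraph.cycle (with_proj H) p" "3 \<le> length p"
  then obtain a b c d where abcd: "p = a # b # c # d"
    by (metis (no_types, opaque_lifting) Suc_le_length_iff numeral_3_eq_3)
  obtain u where u: "pre_digraph.awalk (with_proj H) u p u"
    "distinct (tl (pre_digraph.awalk_verts (with_proj H) u p))"
    using p(1) unfolding pre_digraph.cycle_def by blast
  have walk: "set p \<subseteq> parcs H" "pcas u p u" "distinct (tl (pawalk_verts u p))"
    using u by (auto simp: pre_digraph.awalk_def cas_with_proj_eq awalk_verts_with_proj_eq)
  \<comment> \<open>Only the tail of the vertex list is known to be distinct. The start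
    \<open>u\<close> is also the end of the cycle, so it occurs in that tail.\<close>
  have last: "y \<in> set (pawalk_verts x q)" if "pcas x q y" for x y :: 'a and q
    using that by (induction q arbitrary: x) auto
  have "fst a = u" "snd a = fst b" "snd b = fst c" "pcas (snd c) d u"
    using walk(2) by (simp_all add: abcd)
  moreover have "u \<in> set (pawalk_verts (snd c) d)" using calculation(4) last by blast
  moreover have "hd (pawalk_verts (snd c) d) = snd c" "pawalk_verts (snd c) d \<noteq> []"
    by (cases d; use calculation(4) in simp)+
  then have "snd c \<in> set (pawalk_verts (snd c) d)" by (metis hd_in_set)
  moreover have "distinct (fst b # fst c # pawalk_verts (snd c) d)"
    using walk(3) by (simp add: abcd)
  moreover have "fst a = w \<or> snd a = w" "fst b = w \<or> snd b = w" "fst c = w \<or> snd c = w"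
    using walk(1) assms by (auto simp: abcd)
  ultimately show False by auto
qed

lemma out_degree_pair: "out_degree (with_proj H) v = card (parcs H `` {v})"
proof -
  have "out_arcs (with_proj H) v = Pair v ` (parcs H `` {v})" by (auto simp: out_arcs_def)
  then show ?thesis by (simp add: out_degree_def card_image inj_on_def)
qed

text \<open>Every vertex other than the centre has degree at most 1; a centre of degree at least 2
  excludes the tie in a single edge.\<close>

lemma star_unique_max_degree:
  assumes w: "w \<in> pverts H" "2 \<le> card (parcs H `` {w})"
    and star: "parcs H \<subseteq> {w} \<times> V \<union> V \<times> {w}"
  shows "\<exists>!v. max_degree_vertex (with_proj H) v"
proof -
  have leaf: "card (parcs H `` {v}) \<le> 1" if "v \<noteq> w" for v
    using that star card_mono[of "{w}" "parcs H `` {v}"] by auto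
  show ?thesis
  proof (intro ex1I)
    show "max_degree_vertex (with_proj H) w"
      unfolding max_degree_vertex_def out_degree_pair using w leaf
      by (metis with_proj_simps(1) le_trans one_le_numeral order_refl)
    fix v assume "max_degree_vertex (with_proj H) v"
    then have "2 \<le> card (parcs H `` {v})"
      using w unfolding max_degree_vertex_def out_degree_pair by fastforce
    then show "v = w" using leaf[of v] by linarith
  qed
qed

section \<open>The 2-core of a graph covered by two vertices\<close>

lemma two_removable_induce_pair:
  "two_removable (with_proj H \<restriction> U) T \<longleftrightarrow> (\<exists>v\<in>U. T = {v} \<and> card (parcs H `` {v} \<inter> U) < 2)"
  unfolding two_removable_def induce_subgraph_verts
  by (simp only: neighbours_induce_pair cong: bex_cong)

lemma two_core_largest:
  assumes "pair_graph H"
  obtains C where "C \<subseteq> pverts H" "two_core (with_proj H) = with_proj H \<restriction> C"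
    "\<And>v. v \<in> C \<Longrightarrow> 2 \<le> card (parcs H `` {v} \<inter> C)"
    "\<And>W. W \<subseteq> pverts H \<Longrightarrow> (\<And>v. v \<in> W \<Longrightarrow> 2 \<le> card (parcs H `` {v} \<inter> W)) \<Longrightarrow> W \<subseteq> C"
proof -
  note H = pair_graph_facts[OF assms]
  have core: "is_core two_removable (with_proj H) (two_core (with_proj H))"
    unfolding two_core_def by (rule theI'[OF two_core_unique[OF H(1)]])
  have stable: "(\<nexists>T. two_removable (with_proj H \<restriction> W) T) \<longleftrightarrow> (\<forall>v\<in>W. 2 \<le> card (parcs H `` {v} \<inter> W))"
    for W unfolding two_removable_induce_pair by (auto simp: not_less)
  show thesis
  proof (rule is_core_largest[OF H(1) core])
    fix V T W
    assume V: "V \<subseteq> verts (with_proj H)" and T: "two_removable (with_proj H \<restriction> V) T"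
      and W: "W \<subseteq> V" "\<nexists>T'. two_removable (with_proj H \<restriction> W) T'"
    show "T \<inter> W = {}"
    proof -
      obtain v where v: "v \<in> V" "T = {v}" "card (parcs H `` {v} \<inter> V) < 2"
        using T unfolding two_removable_induce_pair by blast
      have "card (parcs H `` {v} \<inter> W) \<le> card (parcs H `` {v} \<inter> V)"
        using V W H(2) by (intro card_mono) (auto intro: finite_subset)
      then have "v \<notin> W" using W(2) v(3) unfolding stable by fastforce
      then show ?thesis using v by simp
    qed
  next
    fix C
    assume C: "C \<subseteq> verts (with_proj H)" "two_core (with_proj H) = with_proj H \<restriction> C"
      "\<nexists>T. two_removable (with_proj H \<restriction> C) T"
      "\<And>W. W \<subseteq> verts (with_proj H) \<Longrightarrow> \<nexists>T. two_removable (with_proj H \<restriction> W) T \<Longrightarrow> W \<subseteq> C"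
    show thesis using that[of C] C unfolding stable by simp
  qed
qed

text \<open>\<open>u\<close> and \<open>v\<close> see all common neighbours, and each common
  neighbour sees \<open>u\<close> and \<open>v\<close>, so this set survives. Any other vertex has
  neighbours only among \<open>u\<close> and \<open>v\<close>, and not both.\<close>

lemma two_core_double_star:
  assumes H: "pair_graph H" and uv: "u \<in> pverts H" "v \<in> pverts H" "u \<noteq> v"
    and star: "parcs H \<subseteq> {u, v} \<times> V \<union> V \<times> {u, v}"
    and common: "2 \<le> card (parcs H `` {u} \<inter> parcs H `` {v})"
  shows "two_core (with_proj H) = with_proj H \<restriction> ({u, v} \<union> parcs H `` {u} \<inter> parcs H `` {v})"
proof -
  let ?E = "parcs H" let ?P = "?E `` {u} \<inter> ?E `` {v}"
  note H' = pair_graph_facts[OF H]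
  obtain C where C: "C \<subseteq> pverts H" "two_core (with_proj H) = with_proj H \<restriction> C"
    "\<And>x. x \<in> C \<Longrightarrow> 2 \<le> card (?E `` {x} \<inter> C)"
    "\<And>W. W \<subseteq> pverts H \<Longrightarrow> (\<And>x. x \<in> W \<Longrightarrow> 2 \<le> card (?E `` {x} \<inter> W)) \<Longrightarrow> W \<subseteq> C"
    using two_core_largest[OF H] by blast
  have P: "?P \<subseteq> pverts H" "u \<notin> ?P" "v \<notin> ?P" using H' by (auto simp: irrefl_def)
  then have fP: "finite ?P" using H'(2) finite_subset by blast
  have "{u, v} \<union> ?P \<subseteq> C"
  proof (rule C(4))
    fix x assume "x \<in> {u, v} \<union> ?P"
    then have "?P \<subseteq> ?E `` {x} \<inter> ({u, v} \<union> ?P) \<or> {u, v} \<subseteq> ?E `` {x} \<inter> ({u, v} \<union> ?P)"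
      using H'(4) by (auto dest: symD)
    moreover have "finite (?E `` {x} \<inter> ({u, v} \<union> ?P))" using fP by simp
    ultimately have "card ?P \<le> card (?E `` {x} \<inter> ({u, v} \<union> ?P))
        \<or> card {u, v} \<le> card (?E `` {x} \<inter> ({u, v} \<union> ?P))"
      using card_mono by blast
    then show "2 \<le> card (?E `` {x} \<inter> ({u, v} \<union> ?P))" using common uv by auto
  qed (use P uv in auto)
  moreover have "C \<subseteq> {u, v} \<union> ?P"
  proof
    fix x assume x: "x \<in> C"
    show "x \<in> {u, v} \<union> ?P"
    proof (rule ccontr)
      assume no: "x \<notin> {u, v} \<union> ?P"
      then have "?E `` {x} \<inter> C \<subseteq> {u} \<or> ?E `` {x} \<inter> C \<subseteq> {v}"
        using star H'(4) by (auto dest: symD)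
      then have "card (?E `` {x} \<inter> C) \<le> 1"
        using card_mono[of "{u}" "?E `` {x} \<inter> C"] card_mono[of "{v}" "?E `` {x} \<inter> C"] by auto
      then show False using C(3)[OF x] by simp
    qed
  qed
  ultimately show ?thesis using C(2) by (metis subset_antisym)
qed

text \<open>The common neighbours \<open>P\<close> are independent because every arc meets
  \<open>u\<close> or \<open>v\<close>. Whether \<open>u\<close> and \<open>v\<close> are adjacent
  decides between the two complete multipartite graphs.\<close>

lemma double_star_two_core:
  assumes H: "pair_graph H" and uv: "u \<in> pverts H" "v \<in> pverts H" "u \<noteq> v"
    and star: "parcs H \<subseteq> {u, v} \<times> V \<union> V \<times> {u, v}"
    and common: "3 \<le> card (parcs H `` {u} \<inter> parcs H `` {v})"
  shows "\<exists>p\<ge>3. K\<^bsub>2,p\<^esub> (two_core (with_proj H)) \<or> K\<^bsub>1,1,p\<^esub> (two_core (with_proj H))"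
proof -
  let ?E = "parcs H"
  define P where "P = ?E `` {u} \<inter> ?E `` {v}"
  let ?G = "with_proj H \<restriction> ({u, v} \<union> P)"
  note H' = pair_graph_facts[OF H]
  have core: "two_core (with_proj H) = ?G"
    using two_core_double_star[OF H uv star] common by (simp add: P_def)
  have P: "P \<subseteq> pverts H" "u \<notin> P" "v \<notin> P" using H' by (auto simp: irrefl_def P_def)
  have G: "graph ?G" using graph_induce[OF _ H'(1)] P uv by simp
  have adj: "(u, x) \<in> ?E" "(x, u) \<in> ?E" "(v, x) \<in> ?E" "(x, v) \<in> ?E" if "x \<in> P" for x
    using that H'(4) by (auto simp: P_def dest: symD)
  have loop: "(u, u) \<notin> ?E" "(v, v) \<notin> ?E" using H'(5) by (auto simp: irrefl_def)
  have indep: "(x, y) \<notin> ?E" if "x \<in> P" "y \<in> P" for x y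
    using that star P by blast
  show ?thesis
  proof (cases "(u, v) \<in> ?E")
    case True
    then have "(v, u) \<in> ?E" using H'(4) by (auto dest: symD)
    then have arcs: "?E \<inter> ({u, v} \<union> P) \<times> ({u, v} \<union> P)
        = {u} \<times> {v} \<union> {v} \<times> {u} \<union> {u} \<times> P \<union> P \<times> {u} \<union> {v} \<times> P \<union> P \<times> {v}"
      using True by (intro set_eqI) (auto simp: adj loop indep)
    have "K\<^bsub>1,1,card P\<^esub> ?G"
      unfolding complete_tripartite_digraph_def arcs_ends_induce_pair induce_subgraph_verts arcs
      by (rule conjI[OF G], rule exI[of _ "{u}"], rule exI[of _ "{v}"], rule exI[of _ P])
        (use P uv in \<open>simp add: insert_commute\<close>)
    then show ?thesis using common unfolding core P_def by blast
  next
    case False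
    then have "(v, u) \<notin> ?E" using H'(4) by (auto dest: symD)
    then have arcs: "?E \<inter> ({u, v} \<union> P) \<times> ({u, v} \<union> P) = {u, v} \<times> P \<union> P \<times> {u, v}"
      using False by (intro set_eqI) (auto simp: adj loop indep)
    have "K\<^bsub>2,card P\<^esub> ?G"
      unfolding complete_bipartite_digraph_def arcs_ends_induce_pair induce_subgraph_verts arcs
      by (rule conjI[OF G], rule exI[of _ "{u, v}"], rule exI[of _ P]) (use P uv in simp)
    then show ?thesis using common unfolding core P_def by blast
  qed
qed

lemma favourable_graph:
  assumes H: "pair_graph H" and C: "C \<subseteq> pverts H" "three_star_core (with_proj H) = with_proj H \<restriction> C"
    and fav: "favourable (parcs H) (pverts H) C"
  shows "clique (with_proj H)
    \<or> (undirected_forest (with_proj H) \<and> (\<exists>!v. max_degree_vertex (with_proj H) v))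
    \<or> (\<exists>p \<ge> 3. K\<^bsub>2,p\<^esub> (two_core (with_proj H)) \<or> K\<^bsub>1,1,p\<^esub> (two_core (with_proj H)))
    \<or> (k_connected 3 (three_star_core (with_proj H)) \<and> \<not> clique (three_star_core (with_proj H)))"
  using fav unfolding favourable_def
proof (elim disjE bexE conjE)
  assume *: "complete_on (parcs H) (pverts H)"
  have whole: "with_proj H \<restriction> pverts H = with_proj H"
    using induce_verts[OF graph_wf[OF pair_graph_facts(1)[OF H]]] by simp
  have "clique (with_proj H)" using clique_induce_iff[OF H order_refl] * unfolding whole by (rule iffD2)
  then show ?thesis by (rule disjI1)
next
  fix w assume w: "w \<in> pverts H" "parcs H \<subseteq> {w} \<times> pverts H \<union> pverts H \<times> {w}"
    "2 \<le> card (parcs H `` {w})"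
  show ?thesis using star_forest[OF w(2)] star_unique_max_degree[OF w(1,3,2)] by (intro disjI2 disjI1 conjI)
next
  fix u v assume uv: "u \<in> pverts H" "v \<in> pverts H" "u \<noteq> v"
    "parcs H \<subseteq> {u, v} \<times> pverts H \<union> pverts H \<times> {u, v}"
    "3 \<le> card (parcs H `` {u} \<inter> parcs H `` {v})"
  show ?thesis using double_star_two_core[OF H uv] by (intro disjI2 disjI1)
next
  assume *: "5 \<le> card C" "\<nexists>A S B. two_separation (parcs H) C A S B" "\<not> complete_on (parcs H) C"
  have "k_connected 3 (with_proj H \<restriction> C)" by (rule k_connected_3_induce[OF H _ *(2)]) (use *(1) in simp)
  moreover have "\<not> clique (with_proj H \<restriction> C)" unfolding clique_induce_iff[OF H C(1)] by (rule *(3))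
  ultimately show ?thesis unfolding C(2) by (intro disjI2 conjI)
qed

theorem theorem5p1:
  fixes H :: "'a pair_pre_digraph"
  assumes "pair_graph H" and "card (pverts H) \<ge> 12"
  shows "\<exists>X \<in> {with_proj H, with_proj (complement_graph H)}.
      clique X
    \<or> (undirected_forest X \<and> (\<exists>!v. max_degree_vertex X v))
    \<or> (\<exists>p \<ge> 3. K\<^bsub>2,p\<^esub> (two_core X) \<or> K\<^bsub>1,1,p\<^esub> (two_core X))
    \<or> (k_connected 3 (three_star_core X) \<and> \<not> clique (three_star_core X))"
proof -
  let ?H' = "complement_graph H"
  have H': "pair_graph ?H'" by (rule pair_graph_complement_graph[OF assms(1)])
  note facts = pair_graph_facts[OF assms(1)] pair_graph_facts[OF H']
  have verts: "pverts ?H' = pverts H" by (simp add: complement_graph_def)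
  obtain C where C: "largest_stable (parcs H) (pverts H) C"
    "three_star_core (with_proj H) = with_proj H \<restriction> C"
    by (rule three_star_core_largest_stable[OF assms(1)])
  obtain D where D: "largest_stable (parcs ?H') (pverts H) D"
    "three_star_core (with_proj ?H') = with_proj ?H' \<restriction> D"
    using three_star_core_largest_stable[OF H'] unfolding verts .
  have "complementary (pverts H) (parcs H) (parcs ?H')"
  proof
    show "parcs H \<union> parcs ?H' = {(x, y). x \<in> pverts H \<and> y \<in> pverts H \<and> x \<noteq> y}"
      using facts(3,5) by (auto simp: complement_graph_def irrefl_def)
    show "parcs H \<inter> parcs ?H' = {}" by (auto simp: complement_graph_def)
  qed (use facts in auto)
  from complementary.favourable[OF this C(1) D(1) assms(2)] show ?thesis
  proof
    assume fav: "favourable (parcs H) (pverts H) C"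
    have "C \<subseteq> pverts H" using C(1) by (simp add: largest_stable_def)
    from favourable_graph[OF assms(1) this C(2) fav] show ?thesis by (intro bexI[of _ "with_proj H"]) simp_all
  next
    assume fav: "favourable (parcs ?H') (pverts H) D"
    have "D \<subseteq> pverts H" using D(1) by (simp add: largest_stable_def)
    from favourable_graph[OF H' this[folded verts] D(2) fav[folded verts]] show ?thesis
      by (intro bexI[of _ "with_proj ?H'"]) simp_all
  qed
qed

end
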